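(* If $H$ is a hypergraph and $M_H=(m_{ij})_{i,j\in V(H)}$ is a star-dependent matrix, then $\mathfrak{R}_s(H)$ is finer than $\mathfrak{R}_{M_H}$, i.e. $\mathfrak{R}_s(H)\subseteq\mathfrak{R}_{M_H}$.
   Context: A hypergraph $H=(V(H),E(H))$ consists of a finite nonempty vertex set $V(H)$ and a finite family $E(H)$ of nonempty subsets of $V(H)$, called hyperedges. The star of a vertex $i$ is $E_i(H)=\{e\in E(H): i\in e\}$, and $\mathfrak{E}(H)=\{E_i(H): i\in V(H)\}$ is the set of all stars. A real matrix $M_H=(m_{ij})_{i,j\in V(H)}$ is star-dependent if there exist functions $g:\mathfrak{E}(H)\times\mathfrak{E}(H)\to\mathbb{R}$ and $h:\mathfrak{E}(H)\to\mathbb{R}$ such that $m_{ij}=g(E_i(H),E_j(H))$ if $i\neq j$ and $m_{ii}=h(E_i(H))$. $\mathfrak{R}_s(H)$ is the equivalence relation $\{(i,j)\in V(H)\times V(H): E_i(H)=E_j(H)\}$. $\mathfrak{R}_{M_H}$ is the equivalence relation on $V(H)$ consisting of the pairs $(i,j)$ such that $m_{ii}=m_{jj}$, $m_{ij}=m_{ji}$, and $m_{ik}=m_{jk}$, $m_{ki}=m_{kj}$ for all $k\notin\{i,j\}$. *)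

theory Defs
  imports Complex_Main
begin

definition hypergraph :: "'a set \<Rightarrow> 'a set set \<Rightarrow> bool" where
  "hypergraph V E \<longleftrightarrow>
     finite V \<and> V \<noteq> {} \<and> finite E \<and> (\<forall>e\<in>E. e \<noteq> {} \<and> e \<subseteq> V)"

definition star :: "'a set set \<Rightarrow> 'a \<Rightarrow> 'a set set" where
  "star E i = {e \<in> E. i \<in> e}"

text \<open>A matrix indexed by the vertex set \<open>V\<close> is a function of two arguments; its
  entries outside \<open>V \<times> V\<close> are never consulted. Likewise \<open>g\<close> and \<open>h\<close> below are
  total, but only their values on the stars of vertices in \<open>V\<close> matter.\<close>

definition star_dependent :: "'a set \<Rightarrow> 'a set set \<Rightarrow> ('a \<Rightarrow> 'a \<Rightarrow> real) \<Rightarrow> bool" where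
  "star_dependent V E m \<longleftrightarrow>
     (\<exists>(g :: 'a set set \<Rightarrow> 'a set set \<Rightarrow> real) (h :: 'a set set \<Rightarrow> real).
        (\<forall>i\<in>V. \<forall>j\<in>V. i \<noteq> j \<longrightarrow> m i j = g (star E i) (star E j)) \<and>
        (\<forall>i\<in>V. m i i = h (star E i)))"

definition star_rel :: "'a set \<Rightarrow> 'a set set \<Rightarrow> ('a \<times> 'a) set" where
  "star_rel V E = {(i, j). i \<in> V \<and> j \<in> V \<and> star E i = star E j}"

definition matrix_rel :: "'a set \<Rightarrow> ('a \<Rightarrow> 'a \<Rightarrow> real) \<Rightarrow> ('a \<times> 'a) set" where
  "matrix_rel V m = {(i, j). i \<in> V \<and> j \<in> V \<and> m i i = m j j \<and> m i j = m j i \<and>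
     (\<forall>k \<in> V - {i, j}. m i k = m j k \<and> m k i = m k j)}"

lemma equiv_star_rel: "equiv V (star_rel V E)"
  unfolding equiv_def refl_on_def sym_def trans_def star_rel_def by auto

lemma trans_matrix_rel: "trans (matrix_rel V m)"
proof (rule transI)
  fix i j l
  assume ij: "(i, j) \<in> matrix_rel V m" and jl: "(j, l) \<in> matrix_rel V m"
  show "(i, l) \<in> matrix_rel V m"
  proof (cases "i = j \<or> j = l \<or> i = l")
    case True
    then show ?thesis using ij jl by (auto simp: matrix_rel_def)
  next
    case False
    then have V: "i \<in> V" "j \<in> V" "l \<in> V" and d: "m i i = m l l"
      and a: "m i l = m j l" "m l i = m l j" "m i j = m j i"
      and b: "m j i = m l i" "m i j = m i l" "m j l = m l j"
      using ij jl by (auto simp: matrix_rel_def)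
    have "m i k = m l k \<and> m k i = m k l" if "k \<in> V - {i, l}" for k
    proof (cases "k = j")
      case True
      then show ?thesis using a b by simp
    next
      case False
      then show ?thesis using that ij jl by (simp add: matrix_rel_def)
    qed
    then show ?thesis using V a b d by (simp add: matrix_rel_def)
  qed
qed

lemma equiv_matrix_rel: "equiv V (matrix_rel V m)"
proof (rule equivI)
  show "matrix_rel V m \<subseteq> V \<times> V" by (auto simp: matrix_rel_def)
  show "refl_on V (matrix_rel V m)" by (auto simp: refl_on_def matrix_rel_def)
  show "sym (matrix_rel V m)" by (auto simp: sym_def matrix_rel_def)
qed (rule trans_matrix_rel)

end

theory Submission
  imports Defs
begin

text \<open>An entry of a star-dependent matrix sees its two indices only through their stars and
  through whether the indices coincide. Exchanging two vertices with the same star changes neither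
  piece of information, so it leaves every entry fixed; \<^const>\<open>matrix_rel\<close> says exactly
  that this exchange preserves the matrix.\<close>

theorem theorem2p13:
  fixes V :: "'a set" and E :: "'a set set" and m :: "'a \<Rightarrow> 'a \<Rightarrow> real"
  assumes "hypergraph V E"
    and "star_dependent V E m"
  shows "star_rel V E \<subseteq> matrix_rel V m"
proof (rule subrelI)
  fix i j
  assume "(i, j) \<in> star_rel V E"
  then have V: "i \<in> V" "j \<in> V" and st: "star E i = star E j"
    by (auto simp: star_rel_def)
  obtain g h where
    off: "\<And>a b. a \<in> V \<Longrightarrow> b \<in> V \<Longrightarrow> a \<noteq> b \<Longrightarrow> m a b = g (star E a) (star E b)" and
    diag: "\<And>a. a \<in> V \<Longrightarrow> m a a = h (star E a)"
    using assms(2) unfolding star_dependent_def by blast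
  have "m i i = m j j"
    using V st by (simp add: diag)
  \<comment> \<open>\<open>g\<close> need not be symmetric: for \<open>i \<noteq> j\<close> both entries equal \<open>g S S\<close>, where \<open>S\<close> is the
    common star.\<close>
  moreover have "m i j = m j i"
    using V st by (cases "i = j") (simp_all add: off)
  \<comment> \<open>As \<open>k\<close> differs from both \<open>i\<close> and \<open>j\<close>, all four entries are off the diagonal and
    hence given by \<open>g\<close>.\<close>
  moreover have "m i k = m j k \<and> m k i = m k j" if "k \<in> V - {i, j}" for k
    using that V st by (auto simp: off)
  ultimately show "(i, j) \<in> matrix_rel V m"
    using V by (simp add: matrix_rel_def)
qed

end
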